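(* Let $\alpha>0$, $\beta>0$, $\mu_x,\rho\in\mathbb{R}$ and $\sigma^2>0$. Suppose that log consumption growth $x_{t+1}=\ln(c_{t+1}/c_t)$ satisfies $x_{t+1}=\mu_x+\varepsilon_{t+1}+\rho\,\varepsilon_t$ for all $t\ge 0$, where $(\varepsilon_t)_{t\ge0}$ are i.i.d. Gaussian innovations with mean $0$ and variance $\sigma^2$, and let $\sigma_x^2=\operatorname{Var}(x_{t+1})=(1+\rho^2)\sigma^2$. If an equilibrium exists in the isoelastic economy with parameters $\alpha,\beta$ (that is, for every $t\ge 0$ the series $\sum_{i=1}^{\infty}E_t\left[\beta^i\frac{U'(c_{t+i})}{U'(c_t)}c_{t+i}\right]$ defining the asset price converges almost surely to a finite value), then $$\beta<\beta'=\exp\left[-(1-\alpha)\mu_x-\frac{(1-\alpha)^2}{2}\sigma_x^2\right]\exp\left[-\frac{\rho(1-\alpha)^2\sigma_x^2}{1+\rho^2}\right].$$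
   Context: The economy is a Lucas-type exchange economy in discrete time $t=0,1,2,\dots$ on a probability space with filtration $(\mathcal{F}_t)_{t\ge0}$; $E_t[\cdot]=E[\cdot\mid\mathcal{F}_t]$ denotes expectation conditional on period-$t$ information. The process $(\varepsilon_t)$ is adapted to $(\mathcal{F}_t)$ and, for each $t$, the future innovations $(\varepsilon_{t+1},\varepsilon_{t+2},\dots)$ are independent of $\mathcal{F}_t$. Per capita consumption $c_t>0$ is $\mathcal{F}_t$-measurable and is also the dividend paid in period $t$ by the single equity share. A representative household has preferences $E_0\{\sum_{t=0}^\infty\beta^tU(c_t)\}$ with subjective discount factor $\beta>0$ and isoelastic period utility $U(c)=\frac{c^{1-\alpha}}{1-\alpha}$, $\alpha>0$, so that $U'(c)=c^{-\alpha}$ (for $\alpha=1$, take $U=\ln$). The fundamental pricing relationship is $p_t=E_t\left[\beta\frac{U'(c_{t+1})}{U'(c_t)}(p_{t+1}+c_{t+1})\right]$, where $p_t$ is the price of the equity share. Under the no-bubble condition the equilibrium price is $p_t=\sum_{i=1}^{\infty}E_t\left[\beta^i\frac{U'(c_{t+i})}{U'(c_t)}c_{t+i}\right]$. Equilibrium is said to exist when, for every $t$, this series of positive terms converges almost surely (so that $p_t$ is positive and finite). *)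

theory Defs
  imports "HOL-Probability.Probability"
begin

definition isoelastic :: "real \<Rightarrow> real \<Rightarrow> real" where
  "isoelastic \<alpha> c = (if \<alpha> = 1 then ln c else c powr (1 - \<alpha>) / (1 - \<alpha>))"

abbreviation marginal_utility :: "real \<Rightarrow> real \<Rightarrow> real" where
  "marginal_utility \<alpha> \<equiv> deriv (isoelastic \<alpha>)"

lemma marginal_utility_eq:
  assumes "c > 0"
  shows "marginal_utility \<alpha> c = c powr (- \<alpha>)"
proof -
  have *: "isoelastic \<alpha> = (if \<alpha> = 1 then ln else (\<lambda>c. c powr (1 - \<alpha>) / (1 - \<alpha>)))"
    by (auto simp: isoelastic_def)
  have "(isoelastic \<alpha> has_real_derivative c powr (- \<alpha>)) (at c)"
    using assms unfolding *
    by (auto intro!: derivative_eq_intros simp: powr_minus divide_inverse)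
  then show ?thesis
    by (rule DERIV_imp_deriv)
qed

text \<open>
  The summand is nonnegative, so both its conditional expectation and the series are taken in
  \<open>[0, \<infinity>]\<close>. The real-valued \<^const>\<open>real_cond_exp\<close> and \<^const>\<open>suminf\<close> on the reals are unsuitable
  here: they take junk values where the conditional expectation is infinite or the series diverges.
\<close>

definition equity_price ::
  "'a measure \<Rightarrow> (nat \<Rightarrow> 'a measure) \<Rightarrow> real \<Rightarrow> real \<Rightarrow> (nat \<Rightarrow> 'a \<Rightarrow> real) \<Rightarrow> nat \<Rightarrow> 'a \<Rightarrow> ennreal" where
  "equity_price M F \<alpha> \<beta> c t \<omega> =
    (\<Sum>i. nn_cond_exp M (F t)
       (\<lambda>\<omega>. ennreal (\<beta> ^ Suc i * (marginal_utility \<alpha> (c (t + Suc i) \<omega>) / marginal_utility \<alpha> (c t \<omega>))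
                      * c (t + Suc i) \<omega>)) \<omega>)"

definition equilibrium_exists ::
  "'a measure \<Rightarrow> (nat \<Rightarrow> 'a measure) \<Rightarrow> real \<Rightarrow> real \<Rightarrow> (nat \<Rightarrow> 'a \<Rightarrow> real) \<Rightarrow> bool" where
  "equilibrium_exists M F \<alpha> \<beta> c \<longleftrightarrow> (\<forall>t. AE \<omega> in M. equity_price M F \<alpha> \<beta> c t \<omega> < \<infinity>)"

definition future_events ::
  "'a measure \<Rightarrow> (nat \<Rightarrow> 'a \<Rightarrow> real) \<Rightarrow> nat \<Rightarrow> 'a set set" where
  "future_events M \<epsilon> t =
    sigma_sets (space M) (\<Union>s\<in>{t<..}. {\<epsilon> s -` A \<inter> space M | A. A \<in> sets borel})"

end

theory Submission
  imports Defs
begin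

text \<open>
  With \<open>k = 1 - \<alpha>\<close>, the price at time \<open>0\<close> is a geometric series. Log consumption growth over
  \<open>n + 1\<close> periods equals \<open>(n + 1) \<mu>\<^sub>x + \<rho> \<epsilon>\<^sub>0 + (1 + \<rho>) (\<epsilon>\<^sub>1 + \<dots> + \<epsilon>\<^sub>n) + \<epsilon>\<^sub>n\<^sub>+\<^sub>1\<close>: each
  intermediate shock enters twice. Since the future shocks are independent of the current
  information, the Gaussian moment generating function shows that the conditional expectation of the
  \<open>n\<close>-th summand is a positive random variable times \<open>r ^ (n + 1)\<close>, where
  \<open>r = \<beta> exp (k \<mu>\<^sub>x + k\<^sup>2 (1 + \<rho>)\<^sup>2 \<sigma>\<^sup>2 / 2)\<close>. Convergence forces \<open>r < 1\<close>, which is the claim.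
\<close>

section \<open>Gaussian exponential moments and variances\<close>

lemma nn_integral_normal_density:
  assumes "\<sigma> > 0"
  shows "(\<integral>\<^sup>+x. normal_density \<mu> \<sigma> x \<partial>lborel) = 1"
  using assms by (simp add: nn_integral_eq_integral)

text \<open>Completing the square in the exponent: exponential tilting shifts the mean by
  \<open>a * \<sigma>\<^sup>2\<close> and leaves a constant. As the tilted density again integrates
  to 1, that constant is the moment generating function.\<close>

lemma normal_density_mult_exp:
  assumes "\<sigma> > 0"
  shows "normal_density 0 \<sigma> x * exp (a * x) =
    exp (a\<^sup>2 * \<sigma>\<^sup>2 / 2) * normal_density (a * \<sigma>\<^sup>2) \<sigma> x"
proof -
  have "- x\<^sup>2 / (2 * \<sigma>\<^sup>2) + a * x = a\<^sup>2 * \<sigma>\<^sup>2 / 2 + - (x - a * \<sigma>\<^sup>2)\<^sup>2 / (2 * \<sigma>\<^sup>2)"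
    using assms by (simp add: field_simps power2_eq_square)
  then show ?thesis
    by (simp add: normal_density_def exp_add [symmetric] mult.left_commute)
qed

lemma (in prob_space) normal_distributed_mgf:
  assumes "\<sigma> > 0" and "distributed M lborel X (normal_density 0 \<sigma>)"
  shows "(\<integral>\<^sup>+\<omega>. ennreal (exp (a * X \<omega>)) \<partial>M) = ennreal (exp (a\<^sup>2 * \<sigma>\<^sup>2 / 2))"
proof -
  have "(\<integral>\<^sup>+\<omega>. ennreal (exp (a * X \<omega>)) \<partial>M) =
      (\<integral>\<^sup>+x. ennreal (normal_density 0 \<sigma> x) * ennreal (exp (a * x)) \<partial>lborel)"
    by (rule distributed_nn_integral [OF assms(2), symmetric]) simp
  also have "\<dots> = (\<integral>\<^sup>+x. ennreal (exp (a\<^sup>2 * \<sigma>\<^sup>2 / 2)) * ennreal (normal_density (a * \<sigma>\<^sup>2) \<sigma> x) \<partial>lborel)"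
    using assms(1) by (simp add: ennreal_mult'' [symmetric] normal_density_mult_exp)
  also have "\<dots> = ennreal (exp (a\<^sup>2 * \<sigma>\<^sup>2 / 2))"
    using assms(1) by (simp add: nn_integral_cmult nn_integral_normal_density)
  finally show ?thesis .
qed

text \<open>The exponential of the sum is a product of functions of independent variables, so its
  expectation splits into one-dimensional Gaussian factors whose exponents add up.\<close>

lemma (in prob_space) indep_normal_sum_mgf:
  fixes X :: "'i \<Rightarrow> 'a \<Rightarrow> real"
  assumes "\<sigma> > 0" and "finite I" and "indep_vars (\<lambda>_. borel) X I"
    and "\<And>i. i \<in> I \<Longrightarrow> distributed M lborel (X i) (normal_density 0 \<sigma>)"
  shows "(\<integral>\<^sup>+\<omega>. ennreal (exp (\<Sum>i\<in>I. a i * X i \<omega>)) \<partial>M) =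
    ennreal (exp ((\<Sum>i\<in>I. (a i)\<^sup>2) * \<sigma>\<^sup>2 / 2))"
proof -
  have "indep_vars (\<lambda>_. borel) (\<lambda>i \<omega>. ennreal (exp (a i * X i \<omega>))) I"
    by (rule indep_vars_compose2 [OF assms(3)]) simp
  then have "(\<integral>\<^sup>+\<omega>. (\<Prod>i\<in>I. ennreal (exp (a i * X i \<omega>))) \<partial>M) =
      (\<Prod>i\<in>I. \<integral>\<^sup>+\<omega>. ennreal (exp (a i * X i \<omega>)) \<partial>M)"
    by (intro indep_vars_nn_integral assms(2)) simp_all
  also have "\<dots> = (\<Prod>i\<in>I. ennreal (exp ((a i)\<^sup>2 * \<sigma>\<^sup>2 / 2)))"
    using assms(1,4) by (intro prod.cong refl normal_distributed_mgf) auto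
  finally show ?thesis
    using assms(2)
    by (simp add: prod_ennreal exp_sum [symmetric] sum_distrib_right sum_divide_distrib)
qed

lemma (in prob_space) variance_indep_normal_combination:
  fixes X :: "'i \<Rightarrow> 'a \<Rightarrow> real"
  assumes "\<sigma> > 0" and "i \<noteq> j" and "indep_vars (\<lambda>_. borel) X {i, j}"
    and "\<And>l. l \<in> {i, j} \<Longrightarrow> distributed M lborel (X l) (normal_density 0 \<sigma>)"
  shows "variance (\<lambda>\<omega>. \<mu> + X i \<omega> + \<rho> * X j \<omega>) = (1 + \<rho>\<^sup>2) * \<sigma>\<^sup>2"
proof (cases "\<rho> = 0")
  \<comment> \<open>With \<open>\<rho> = 0\<close> the second term is the constant 0, which has no
    normal density, so the rule for sums of independent normals is replaced by the affine rule for
    \<open>X i\<close> alone.\<close>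
  case True
  have "distributed M lborel (\<lambda>\<omega>. \<mu> + 1 * X i \<omega>) (normal_density (\<mu> + 1 * 0) (\<bar>1\<bar> * \<sigma>))"
    using assms by (intro normal_density_affine) auto
  from normal_distributed_variance [OF _ this] show ?thesis
    using True assms(1) by simp
next
  case False
  \<comment> \<open>The shift \<open>\<mu>\<close> is attached to the summand \<open>i\<close>, so
    that the whole expression becomes a sum of two independent normals with positive standard
    deviations \<open>\<sigma>\<close> and \<open>\<bar>\<rho>\<bar> * \<sigma>\<close>.\<close>
  define Y where "Y l \<omega> = (if l = i then \<mu> else 0) + (if l = i then 1 else \<rho>) * X l \<omega>" for l \<omega>
  have "indep_vars (\<lambda>_. borel) Y {i, j}"
    unfolding Y_def by (rule indep_vars_compose2 [OF assms(3)]) simp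
  moreover have "distributed M lborel (Y l)
      (normal_density (if l = i then \<mu> else 0) (\<bar>if l = i then 1 else \<rho>\<bar> * \<sigma>))"
    if "l \<in> {i, j}" for l
    using normal_density_affine [OF assms(4) [OF that] assms(1),
        of "if l = i then 1 else \<rho>" "if l = i then \<mu> else 0"] False
    unfolding Y_def by (simp add: Y_def)
  ultimately have "distributed M lborel (\<lambda>\<omega>. \<Sum>l\<in>{i, j}. Y l \<omega>)
      (normal_density (\<Sum>l\<in>{i, j}. if l = i then \<mu> else 0)
        (sqrt (\<Sum>l\<in>{i, j}. (\<bar>if l = i then 1 else \<rho>\<bar> * \<sigma>)\<^sup>2)))"
    using assms(1) False by (intro sum_indep_normal) auto
  from normal_distributed_variance [OF _ this]
  have "variance (\<lambda>\<omega>. \<Sum>l\<in>{i, j}. Y l \<omega>) = \<sigma>\<^sup>2 + (\<rho> * \<sigma>)\<^sup>2"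
    using assms(1,2) by (simp add: power_mult_distrib add_pos_nonneg)
  then show ?thesis
    using assms(2) by (simp add: Y_def algebra_simps power_mult_distrib)
qed

section \<open>Conditional expectation of products under independence\<close>

text \<open>The sigma-algebra generated by a measurable function is contained in the given one, so
  independence of \<open>F\<close> and \<open>G\<close> passes to \<open>f\<close> and
  \<open>g\<close>, and the product rule for independent variables applies.\<close>

lemma (in prob_space) nn_integral_mult_indep_set:
  fixes f g :: "'a \<Rightarrow> ennreal"
  assumes "subalgebra M F" and "subalgebra M G" and "indep_set (sets F) (sets G)"
    and f: "f \<in> borel_measurable F" and g: "g \<in> borel_measurable G"
  shows "(\<integral>\<^sup>+\<omega>. f \<omega> * g \<omega> \<partial>M) = (\<integral>\<^sup>+\<omega>. f \<omega> \<partial>M) * (\<integral>\<^sup>+\<omega>. g \<omega> \<partial>M)"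
proof -
  have generated: "sigma_sets (space M) {h -` A \<inter> space M | A. A \<in> sets borel} \<subseteq> sets H"
    if "subalgebra M H" and "h \<in> borel_measurable H" for h :: "'a \<Rightarrow> ennreal" and H
  proof -
    have "space H = space M"
      using that(1) by (simp add: subalgebra_def)
    then have "{h -` A \<inter> space M | A. A \<in> sets borel} \<subseteq> sets H"
      using measurable_sets [OF that(2)] by auto
    from sets.sigma_sets_subset [OF this] show ?thesis
      using \<open>space H = space M\<close> by simp
  qed
  have "indep_var borel f borel g"
    unfolding indep_var_eq indep_sets2_eq
    using measurable_from_subalg [OF assms(1) f] measurable_from_subalg [OF assms(2) g]
      generated [OF assms(1) f] generated [OF assms(2) g] assms(1-3)
    unfolding subalgebra_def indep_sets2_eq by (meson order_trans subsetD)
  \<comment> \<open>\<open>indep_var\<close> speaks of a family of target spaces indexed by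
    \<open>bool\<close>; here that family is constant, as the product rule for integrals
    requires.\<close>
  moreover have "case_bool borel borel = (\<lambda>_. borel :: ennreal measure)"
    by (simp add: fun_eq_iff split: bool.split)
  ultimately have "indep_vars (\<lambda>_. borel) (case_bool f g) UNIV"
    by (simp add: indep_var_def)
  from indep_vars_nn_integral [OF _ this] show ?thesis
    by (simp add: UNIV_bool mult.commute)
qed

text \<open>Conditional expectation is characterised by its integrals over sets \<open>A\<close> of
  \<open>F\<close>. The indicator of \<open>A\<close> joins the \<open>F\<close>-measurable factor
  \<open>f\<close>, and the integral then factors by independence.\<close>

lemma (in prob_space) nn_cond_exp_mult_indep:
  fixes f g :: "'a \<Rightarrow> ennreal"
  assumes "subalgebra M F" and "subalgebra M G" and "indep_set (sets F) (sets G)"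
    and f [measurable]: "f \<in> borel_measurable F" and g: "g \<in> borel_measurable G"
  shows "AE \<omega> in M. f \<omega> * (\<integral>\<^sup>+\<omega>. g \<omega> \<partial>M) = nn_cond_exp M F (\<lambda>\<omega>. f \<omega> * g \<omega>) \<omega>"
proof -
  interpret finite_measure_subalgebra M F
    using assms(1) by unfold_locales
  have [measurable]: "f \<in> borel_measurable M" "g \<in> borel_measurable M"
    using assms measurable_from_subalg by blast+
  show ?thesis
  proof (rule nn_cond_exp_charact)
    fix A assume [measurable]: "A \<in> sets F"
    then have [measurable]: "A \<in> sets M"
      using assms(1) by (auto simp: subalgebra_def)
    have "(\<integral>\<^sup>+\<omega>. f \<omega> * g \<omega> * indicator A \<omega> \<partial>M) = (\<integral>\<^sup>+\<omega>. (f \<omega> * indicator A \<omega>) * g \<omega> \<partial>M)"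
      by (simp add: mult_ac)
    also have "\<dots> = (\<integral>\<^sup>+\<omega>. f \<omega> * indicator A \<omega> \<partial>M) * (\<integral>\<^sup>+\<omega>. g \<omega> \<partial>M)"
      by (rule nn_integral_mult_indep_set [OF assms(1-3) _ g]) measurable
    also have "\<dots> = (\<integral>\<^sup>+\<omega>. (f \<omega> * indicator A \<omega>) * (\<integral>\<^sup>+\<omega>. g \<omega> \<partial>M) \<partial>M)"
      by (subst nn_integral_multc) auto
    finally show "(\<integral>\<^sup>+\<omega>\<in>A. (f \<omega> * g \<omega>) \<partial>M) = (\<integral>\<^sup>+\<omega>\<in>A. (f \<omega> * (\<integral>\<^sup>+\<omega>. g \<omega> \<partial>M)) \<partial>M)"
      by (simp add: mult_ac)
  qed measurable
qed

section \<open>Consumption growth and the terms of the price\<close>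

text \<open>Log growth telescopes. The bracket collects what is known at time 0, the sum only later
  shocks; this is the split that conditioning on time-0 information uses.\<close>

lemma ln_growth_sum:
  fixes c \<epsilon> :: "nat \<Rightarrow> real"
  assumes "\<And>t. c t > 0"
    and "\<And>t. ln (c (t + 1) / c t) = \<mu> + \<epsilon> (t + 1) + \<rho> * \<epsilon> t"
  shows "ln (c (Suc n) / c 0) =
    (\<mu> * Suc n + \<rho> * \<epsilon> 0) + (\<Sum>j=1..Suc n. (if j = Suc n then 1 else 1 + \<rho>) * \<epsilon> j)"
proof (induction n)
  case 0
  show ?case
    using assms(2) [of 0] by simp
next
  case (Suc n)
  have "ln (c (Suc (Suc n)) / c 0) = ln (c (Suc (Suc n)) / c (Suc n)) + ln (c (Suc n) / c 0)"
    using assms(1) [THEN less_imp_neq, THEN not_sym] by (simp add: ln_div)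
  also have "\<dots> = \<mu> + \<epsilon> (Suc (Suc n)) + \<rho> * \<epsilon> (Suc n) + (\<mu> * Suc n + \<rho> * \<epsilon> 0)
      + (\<Sum>j=1..Suc n. (if j = Suc n then 1 else 1 + \<rho>) * \<epsilon> j)"
    using assms(2) [of "Suc n"] Suc.IH by simp
  \<comment> \<open>The shock at \<open>Suc n\<close> is isolated because its coefficient changes:
    it was the last one, with weight 1, and the new period adds its lagged effect
    \<open>\<rho>\<close>.\<close>
  also have "(\<Sum>j=1..Suc n. (if j = Suc n then 1 else 1 + \<rho>) * \<epsilon> j) =
      \<epsilon> (Suc n) + (\<Sum>j=1..n. (1 + \<rho>) * \<epsilon> j)"
    by simp
  finally show ?case
    by (simp add: algebra_simps)
qed

text \<open>Since marginal utility is \<open>c powr (- \<alpha>)\<close>, the left side is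
  \<open>x\<close> times \<open>(y / x) powr (1 - \<alpha>)\<close>. Apart from the current level
  \<open>x\<close>, it depends on growth only.\<close>

lemma marginal_utility_ratio_mult:
  assumes "x > 0" and "y > 0"
  shows "marginal_utility \<alpha> y / marginal_utility \<alpha> x * y = x * exp ((1 - \<alpha>) * ln (y / x))"
  using assms
  by (simp add: marginal_utility_eq powr_def ln_div exp_diff exp_minus algebra_simps exp_add field_simps)

lemma summable_pos_geometric_less_1:
  fixes r :: real
  assumes "K > 0" and "r > 0" and "(\<Sum>n. ennreal (K * r ^ n)) < \<infinity>"
  shows "r < 1"
proof -
  have "summable (\<lambda>n. K * r ^ n)"
    using assms by (intro summable_suminf_not_top) auto
  then have "summable (\<lambda>n. r ^ n)"
    using assms(1) by (simp add: summable_cmult_iff)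
  then show ?thesis
    using assms(2) by (simp add: summable_geometric_iff)
qed

section \<open>Variance of growth and the bound on the discount factor\<close>

theorem theorem1:
  fixes M :: "'a measure" and F :: "nat \<Rightarrow> 'a measure"
    and c \<epsilon> :: "nat \<Rightarrow> 'a \<Rightarrow> real"
    and \<alpha> \<beta> \<mu>\<^sub>x \<rho> \<sigma> \<sigma>\<^sub>x_sq :: real
  assumes "prob_space M"
    and "filtration (space M) F"
    and "\<And>t. subalgebra M (F t)"
    and "\<alpha> > 0" and "\<beta> > 0" and "\<sigma> > 0"
    and "\<And>t. c t \<in> borel_measurable (F t)"
    and "\<And>t \<omega>. \<omega> \<in> space M \<Longrightarrow> c t \<omega> > 0"
    and "\<And>t. \<epsilon> t \<in> borel_measurable (F t)"
    and "\<And>t. prob_space.indep_set M (sets (F t)) (future_events M \<epsilon> t)"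
    and "prob_space.indep_vars M (\<lambda>_. borel) \<epsilon> UNIV"
    and "\<And>t. distributed M lborel (\<epsilon> t) (normal_density 0 \<sigma>)"
    and "\<And>t. AE \<omega> in M. ln (c (t + 1) \<omega> / c t \<omega>) = \<mu>\<^sub>x + \<epsilon> (t + 1) \<omega> + \<rho> * \<epsilon> t \<omega>"
    and "\<sigma>\<^sub>x_sq = (1 + \<rho>\<^sup>2) * \<sigma>\<^sup>2"
    and "equilibrium_exists M F \<alpha> \<beta> c"
  shows "(\<forall>t. prob_space.variance M (\<lambda>\<omega>. ln (c (t + 1) \<omega> / c t \<omega>)) = \<sigma>\<^sub>x_sq) \<and>
    \<beta> < exp (- (1 - \<alpha>) * \<mu>\<^sub>x - (1 - \<alpha>)\<^sup>2 / 2 * \<sigma>\<^sub>x_sq) *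
        exp (- (\<rho> * (1 - \<alpha>)\<^sup>2 * \<sigma>\<^sub>x_sq / (1 + \<rho>\<^sup>2)))"
proof -
  interpret prob_space M by fact
  note sub = assms(3) and pos = assms(8) and normal = assms(12)
  have c_meas: "c t \<in> borel_measurable M" and eps_meas: "\<epsilon> t \<in> borel_measurable M" for t
    using measurable_from_subalg [OF sub] assms(7,9) by blast+
  define k where "k = 1 - \<alpha>"

  have "variance (\<lambda>\<omega>. ln (c (t + 1) \<omega> / c t \<omega>)) = \<sigma>\<^sub>x_sq" for t
  proof -
    \<comment> \<open>The growth equation holds only almost surely, so it is substituted separately
      in the mean inside the variance and in the outer integral.\<close>
    have E: "expectation (\<lambda>\<omega>. ln (c (t + 1) \<omega> / c t \<omega>)) =
        expectation (\<lambda>\<omega>. \<mu>\<^sub>x + \<epsilon> (t + 1) \<omega> + \<rho> * \<epsilon> t \<omega>)"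
      using assms(13) [of t] c_meas eps_meas by (intro integral_cong_AE) auto
    have "variance (\<lambda>\<omega>. ln (c (t + 1) \<omega> / c t \<omega>)) =
        variance (\<lambda>\<omega>. \<mu>\<^sub>x + \<epsilon> (t + 1) \<omega> + \<rho> * \<epsilon> t \<omega>)"
      unfolding E using assms(13) [of t] c_meas eps_meas by (intro integral_cong_AE) auto
    also have "\<dots> = (1 + \<rho>\<^sup>2) * \<sigma>\<^sup>2"
      using assms(6) normal
      by (intro variance_indep_normal_combination indep_vars_subset [OF assms(11)]) auto
    finally show ?thesis
      using assms(14) by simp
  qed

  moreover have "\<beta> < exp (- (1 - \<alpha>) * \<mu>\<^sub>x - (1 - \<alpha>)\<^sup>2 / 2 * \<sigma>\<^sub>x_sq) *
      exp (- (\<rho> * (1 - \<alpha>)\<^sup>2 * \<sigma>\<^sub>x_sq / (1 + \<rho>\<^sup>2)))"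
  proof -
    \<comment> \<open>\<open>G\<close> packages the set family
      \<open>future_events M \<epsilon> 0\<close> as a measure space, so that measurability and
      subalgebra facts can be stated for it.\<close>
    define G where "G = sigma (space M)
      (\<Union>s\<in>{0<..}. {\<epsilon> s -` A \<inter> space M | A. A \<in> sets borel})"
    have sets_G: "sets G = future_events M \<epsilon> 0" and space_G: "space G = space M"
      unfolding G_def future_events_def
      by (subst sets_measure_of, auto simp: space_measure_of_conv)
    have sub_G: "subalgebra M G"
      using assms(10) [of 0] by (auto simp: subalgebra_def space_G sets_G indep_sets2_eq)
    have eps_G: "\<epsilon> s \<in> borel_measurable G" if "s > 0" for s
      using that by (intro measurableI) (auto simp: space_G sets_G future_events_def)

    \<comment> \<open>\<open>W\<close> is the random factor known at time 0 and \<open>S n\<close>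
      the exponent due to later shocks. One more period of maturity contributes the discount factor,
      the drift and one more shock of weight \<open>k * (1 + \<rho>)\<close>, giving the ratio
      \<open>r\<close>. The constant \<open>C\<close> belongs to the shortest maturity, whose only
      future shock has weight \<open>k\<close>. Index \<open>n\<close> means maturity
      \<open>Suc n\<close>.\<close>
    define W where "W \<omega> = c 0 \<omega> * exp (k * \<rho> * \<epsilon> 0 \<omega>)" for \<omega>
    define a where "a n j = k * (if j = Suc n then 1 else 1 + \<rho>)" for n j :: nat
    define S where "S n \<omega> = (\<Sum>j=1..Suc n. a n j * \<epsilon> j \<omega>)" for n \<omega>
    define r where "r = \<beta> * exp (k * \<mu>\<^sub>x + k\<^sup>2 * (1 + \<rho>)\<^sup>2 * \<sigma>\<^sup>2 / 2)"
    define C where "C = \<beta> * exp (k * \<mu>\<^sub>x + k\<^sup>2 * \<sigma>\<^sup>2 / 2)"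
    define u where "u n \<omega> = ennreal (\<beta> ^ Suc n * (marginal_utility \<alpha> (c (0 + Suc n) \<omega>) /
      marginal_utility \<alpha> (c 0 \<omega>)) * c (0 + Suc n) \<omega>)" for n \<omega>
    \<comment> \<open>The countably many exceptional null sets are merged, so that the telescoping
      identity can be used at a fixed state.\<close>
    have "AE \<omega> in M. \<forall>t. ln (c (t + 1) \<omega> / c t \<omega>) = \<mu>\<^sub>x + \<epsilon> (t + 1) \<omega> + \<rho> * \<epsilon> t \<omega>"
      using assms(13) by (simp add: AE_all_countable)
    then have u_eq: "AE \<omega> in M. u n \<omega> =
        ennreal (\<beta> ^ Suc n * exp (k * \<mu>\<^sub>x * Suc n) * W \<omega>) * ennreal (exp (S n \<omega>))" for n
      using AE_space
    proof eventually_elim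
      case (elim \<omega>)
      have "k * ln (c (Suc n) \<omega> / c 0 \<omega>) =
          k * (\<mu>\<^sub>x * Suc n + \<rho> * \<epsilon> 0 \<omega>) + S n \<omega>"
        using elim pos unfolding S_def a_def
        by (subst ln_growth_sum [where \<mu> = "\<mu>\<^sub>x" and \<rho> = \<rho> and \<epsilon> = "\<lambda>j. \<epsilon> j \<omega>"])
           (auto simp: distrib_left sum_distrib_left mult.assoc simp del: sum.cl_ivl_Suc)
      then have "marginal_utility \<alpha> (c (Suc n) \<omega>) / marginal_utility \<alpha> (c 0 \<omega>) * c (Suc n) \<omega> =
          exp (k * \<mu>\<^sub>x * Suc n) * W \<omega> * exp (S n \<omega>)"
        using marginal_utility_ratio_mult [of "c 0 \<omega>" "c (Suc n) \<omega>" \<alpha>] pos elim(2)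
        by (simp add: W_def k_def [symmetric] exp_add mult_ac distrib_left)
      then have "\<beta> ^ Suc n * (marginal_utility \<alpha> (c (Suc n) \<omega>) / marginal_utility \<alpha> (c 0 \<omega>)) *
          c (Suc n) \<omega> = \<beta> ^ Suc n * exp (k * \<mu>\<^sub>x * Suc n) * W \<omega> * exp (S n \<omega>)"
        by (metis mult.assoc)
      then show ?case
        by (simp only: u_def add_0 ennreal_mult'' [symmetric] exp_ge_zero)
    qed
    have W_meas: "W \<in> borel_measurable (F 0)"
      unfolding W_def using assms(7,9) by measurable
    have W_pos: "W \<omega> > 0" if "\<omega> \<in> space M" for \<omega>
      using pos that by (simp add: W_def)
    have "AE \<omega> in M. nn_cond_exp M (F 0) (u n) \<omega> = ennreal (W \<omega> * C * r ^ n)" for n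
    proof -
      interpret F0: finite_measure_subalgebra M "F 0"
        using sub by unfold_locales
      have S_meas: "S n \<in> borel_measurable G"
        unfolding S_def using eps_G by (intro borel_measurable_sum borel_measurable_times) auto
      have f_meas: "(\<lambda>\<omega>. ennreal (\<beta> ^ Suc n * exp (k * \<mu>\<^sub>x * Suc n) * W \<omega>)) \<in> borel_measurable (F 0)"
        using W_meas by measurable
      have g_meas: "(\<lambda>\<omega>. ennreal (exp (S n \<omega>))) \<in> borel_measurable G"
        using S_meas by measurable
      have "(\<integral>\<^sup>+\<omega>. ennreal (exp (S n \<omega>)) \<partial>M) =
          ennreal (exp ((\<Sum>j=1..Suc n. (a n j)\<^sup>2) * \<sigma>\<^sup>2 / 2))"
        unfolding S_def using assms(6) normal
        by (intro indep_normal_sum_mgf indep_vars_subset [OF assms(11)]) auto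
      \<comment> \<open>The final shock contributes \<open>k\<^sup>2\<close>; each of the
        \<open>n\<close> intermediate ones contributes
        \<open>k\<^sup>2 * (1 + \<rho>)\<^sup>2\<close>.\<close>
      also have "(\<Sum>j=1..Suc n. (a n j)\<^sup>2) = k\<^sup>2 + n * (k\<^sup>2 * (1 + \<rho>)\<^sup>2)"
        by (simp add: a_def power_mult_distrib)
      finally have mgf: "(\<integral>\<^sup>+\<omega>. ennreal (exp (S n \<omega>)) \<partial>M) =
          ennreal (exp ((k\<^sup>2 + n * (k\<^sup>2 * (1 + \<rho>)\<^sup>2)) * \<sigma>\<^sup>2 / 2))" .
      have const: "\<beta> ^ Suc n * exp (k * \<mu>\<^sub>x * Suc n) * exp ((k\<^sup>2 + n * (k\<^sup>2 * (1 + \<rho>)\<^sup>2)) * \<sigma>\<^sup>2 / 2) =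
          C * r ^ n"
        by (simp add: C_def r_def power_mult_distrib exp_of_nat_mult [symmetric] exp_add [symmetric])
           (simp add: algebra_simps add_divide_distrib)
      have [measurable]: "c t \<in> borel_measurable M" for t
        by (rule c_meas)
      \<comment> \<open>Measurability is checked for the explicit power form, which agrees with the
        derivative form on the whole space because consumption is positive there.\<close>
      have "u n \<in> borel_measurable M"
      proof -
        have "(\<lambda>\<omega>. ennreal (\<beta> ^ Suc n * (c (Suc n) \<omega> powr (- \<alpha>) / c 0 \<omega> powr (- \<alpha>)) * c (Suc n) \<omega>))
            \<in> borel_measurable M"
          by measurable
        then show ?thesis
          by (rule measurable_cong [THEN iffD1, rotated]) (simp add: u_def pos marginal_utility_eq)
      qed
      then have "AE \<omega> in M. nn_cond_exp M (F 0) (u n) \<omega> = nn_cond_exp M (F 0)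
          (\<lambda>\<omega>. ennreal (\<beta> ^ Suc n * exp (k * \<mu>\<^sub>x * Suc n) * W \<omega>) * ennreal (exp (S n \<omega>))) \<omega>"
        using u_eq measurable_from_subalg [OF sub f_meas] measurable_from_subalg [OF sub_G g_meas]
        by (intro F0.nn_cond_exp_cong) auto
      moreover have "AE \<omega> in M.
          ennreal (\<beta> ^ Suc n * exp (k * \<mu>\<^sub>x * Suc n) * W \<omega>) * (\<integral>\<^sup>+\<omega>. ennreal (exp (S n \<omega>)) \<partial>M) =
          nn_cond_exp M (F 0)
          (\<lambda>\<omega>. ennreal (\<beta> ^ Suc n * exp (k * \<mu>\<^sub>x * Suc n) * W \<omega>) * ennreal (exp (S n \<omega>))) \<omega>"
        using assms(10) [of 0] unfolding sets_G [symmetric]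
        by (intro nn_cond_exp_mult_indep [OF sub sub_G _ f_meas g_meas])
      ultimately show ?thesis
      proof eventually_elim
        case (elim \<omega>)
        have "\<beta> ^ Suc n * exp (k * \<mu>\<^sub>x * Suc n) * W \<omega> *
            exp ((k\<^sup>2 + n * (k\<^sup>2 * (1 + \<rho>)\<^sup>2)) * \<sigma>\<^sup>2 / 2) = W \<omega> * C * r ^ n"
          using const by (metis mult.assoc mult.commute)
        then show ?case
          unfolding elim(1) elim(2) [symmetric] mgf
          by (simp only: ennreal_mult'' [symmetric] exp_ge_zero)
      qed
    qed
    then have "AE \<omega> in M. \<forall>n. nn_cond_exp M (F 0) (u n) \<omega> = ennreal (W \<omega> * C * r ^ n)"
      by (simp add: AE_all_countable)
    moreover have "AE \<omega> in M. (\<Sum>n. nn_cond_exp M (F 0) (u n) \<omega>) < \<infinity>"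
      using assms(15) unfolding equilibrium_exists_def equity_price_def u_def by blast
    ultimately have "AE \<omega> in M. W \<omega> > 0 \<and> (\<Sum>n. ennreal (W \<omega> * C * r ^ n)) < \<infinity>"
      using AE_space by eventually_elim (use W_pos in auto)
    \<comment> \<open>An almost sure event in a probability space is nonempty, so one state suffices
      to reduce the claim to a real geometric series.\<close>
    then obtain \<omega> where "W \<omega> > 0" and "(\<Sum>n. ennreal (W \<omega> * C * r ^ n)) < \<infinity>"
      using AE_E_prob ae_filter_bot eventually_happens' by blast
    moreover have "C > 0" and "r > 0"
      using assms(5) by (simp_all add: C_def r_def)
    ultimately have "r < 1"
      by (intro summable_pos_geometric_less_1 [of "W \<omega> * C" r]) auto
    then have "\<beta> < exp (- (k * \<mu>\<^sub>x + k\<^sup>2 * (1 + \<rho>)\<^sup>2 * \<sigma>\<^sup>2 / 2))"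
      by (simp add: r_def exp_minus field_simps)
    \<comment> \<open>Expanding
      \<open>(1 + \<rho>)\<^sup>2 = (1 + \<rho>\<^sup>2) + 2 * \<rho>\<close> separates the variance
      \<open>\<sigma>\<^sub>x_sq\<close> of growth from its first-order autocovariance
      \<open>\<rho> * \<sigma>\<^sup>2\<close>; these give the two exponential factors of the
      bound.\<close>
    also have "- (k * \<mu>\<^sub>x + k\<^sup>2 * (1 + \<rho>)\<^sup>2 * \<sigma>\<^sup>2 / 2) =
        (- k * \<mu>\<^sub>x - k\<^sup>2 / 2 * \<sigma>\<^sub>x_sq) + - (\<rho> * k\<^sup>2 * \<sigma>\<^sub>x_sq / (1 + \<rho>\<^sup>2))"
    proof -
      have "1 + \<rho>\<^sup>2 \<noteq> 0"
        by (metis add_pos_nonneg less_irrefl zero_le_power2 zero_less_one)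
      then have "\<rho> * k\<^sup>2 * \<sigma>\<^sub>x_sq / (1 + \<rho>\<^sup>2) = \<rho> * k\<^sup>2 * \<sigma>\<^sup>2"
        by (simp add: assms(14))
      then show ?thesis
        by (simp add: assms(14) power2_eq_square field_simps)
    qed
    finally show ?thesis
      unfolding k_def exp_add .
  qed
  ultimately show ?thesis
    by blast
qed

end
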